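(* Let $D$ be any Dyck path, and let $D'=\Phi(D)$. Then (1) $\mathrm{ct}(D)=h(D')$; (2) $\mathrm{rt}(D)=\mathrm{er}(D')$; (3) $\mathrm{lt}(D)+\mathrm{ct}(D)=\mathrm{or}(D')$; (4) $\mathrm{cmt}(D)=\mathrm{ret}(D')$.
   Context: A Dyck path of length $2n$ (semilength $n$) is a lattice path from $(0,0)$ to $(2n,0)$ consisting of up-steps $\mathbf{u}=(1,1)$ and down-steps $\mathbf{d}=(1,-1)$ that never goes below the $x$-axis; it is identified with its word in $\mathbf{u},\mathbf{d}$. $\mathcal{D}_n$ is the set of Dyck paths of length $2n$. Statistics. A hill is a peak ($\mathbf{u}$ immediately followed by $\mathbf{d}$) whose top has height $1$; $h(D)$ is the number of hills of $D$. An odd (resp. even) rise is an up-step in an odd (resp. even) position when the steps are numbered $1,2,\dots$ from left to right; $\mathrm{or}(D)$ and $\mathrm{er}(D)$ are the numbers of odd and even rises. A return is a down-step landing on the $x$-axis; $\mathrm{ret}(D)$ is the number of returns. A tunnel of $D$ is a decomposition $D=A\mathbf{u}B\mathbf{d}C$ with $B$ a (possibly empty) Dyck path, viewed as the horizontal segment from the beginning of the displayed $\mathbf{u}$ to the end of the displayed $\mathbf{d}$. For $D\in\mathcal{D}_n$, the tunnel is centered, right, or left according to whether the $x$-coordinate of its midpoint is equal to, strictly greater than, or strictly less than $n$ (equivalently, the length of $A$ is equal to, greater than, or less than that of $C$). $\mathrm{ct}(D),\mathrm{rt}(D),\mathrm{lt}(D)$ are the numbers of centered, right and left tunnels. A multitunnel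 of $D$ is a decomposition $D=ABC$ with $B$ a nonempty Dyck path (viewed as the segment joining the initial and final points of $B$); it is centered if $A$ and $C$ have the same length. $\mathrm{cmt}(D)$ is the number of centered multitunnels. The map $\Phi:\mathcal{D}_n\to\mathcal{D}_n$. In each tunnel decomposition $D=A\mathbf{u}B\mathbf{d}C$, the displayed $\mathbf{u}$ and $\mathbf{d}$ are called matched; this matches up-steps and down-steps bijectively. Let $\sigma$ be the permutation of $\{1,\dots,2n\}$ with $\sigma_i=\frac{i+1}{2}$ for $i$ odd and $\sigma_i=2n+1-\frac{i}{2}$ for $i$ even. For $i=1,\dots,2n$, consider the $\sigma_i$-th step of $D$; if its matching step in $D$ has not yet been read (i.e. is not among the steps numbered $\sigma_1,\dots,\sigma_{i-1}$), the $i$-th step of $\Phi(D)$ is an up-step; otherwise it is a down-step. The result is a Dyck path. *)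

theory Defs
  imports Complex_Main
begin

section \<open>Dyck paths\<close>

datatype step = Up | Down

type_synonym path = "step list"

primrec rise :: "step \<Rightarrow> int" where
  "rise Up = 1"
| "rise Down = - 1"

definition height :: "path \<Rightarrow> int" where
  "height w = sum_list (map rise w)"

definition is_dyck :: "path \<Rightarrow> bool" where
  "is_dyck w \<longleftrightarrow> height w = 0 \<and> (\<forall>k \<le> length w. 0 \<le> height (take k w))"

definition semilength :: "path \<Rightarrow> nat" where
  "semilength w = length w div 2"

text \<open>
  Steps are numbered \<open>1, 2, \<dots>\<close> from left to right; the library's list indexing starts at \<open>0\<close>.
\<close>

definition nth_step :: "path \<Rightarrow> nat \<Rightarrow> step" where
  "nth_step w i = w ! (i - 1)"

section \<open>Hills, rises and returns\<close>

definition hills :: "path \<Rightarrow> nat" where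
  "hills w = card {i. 1 \<le> i \<and> i < length w \<and> nth_step w i = Up \<and> nth_step w (i + 1) = Down
                      \<and> height (take i w) = 1}"

definition odd_rises :: "path \<Rightarrow> nat" where
  "odd_rises w = card {i \<in> {1..length w}. odd i \<and> nth_step w i = Up}"

definition even_rises :: "path \<Rightarrow> nat" where
  "even_rises w = card {i \<in> {1..length w}. even i \<and> nth_step w i = Up}"

definition returns :: "path \<Rightarrow> nat" where
  "returns w = card {i \<in> {1..length w}. nth_step w i = Down \<and> height (take i w) = 0}"

section \<open>Tunnels and multitunnels\<close>

definition tunnels :: "path \<Rightarrow> (path \<times> path \<times> path) set" where
  "tunnels w = {(A, B, C). w = A @ [Up] @ B @ [Down] @ C \<and> is_dyck B}"

text \<open>
  The \<open>x\<close>-coordinate of the midpoint of a tunnel: the segment runs from \<open>x = |A|\<close> to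
  \<open>x = |A| + |B| + 2\<close>.
\<close>

fun tunnel_mid :: "path \<times> path \<times> path \<Rightarrow> real" where
  "tunnel_mid (A, B, C) = (real (length A) + real (length A + length B + 2)) / 2"

definition centered_tunnels :: "path \<Rightarrow> nat" where
  "centered_tunnels w = card {t \<in> tunnels w. tunnel_mid t = real (semilength w)}"

definition right_tunnels :: "path \<Rightarrow> nat" where
  "right_tunnels w = card {t \<in> tunnels w. tunnel_mid t > real (semilength w)}"

definition left_tunnels :: "path \<Rightarrow> nat" where
  "left_tunnels w = card {t \<in> tunnels w. tunnel_mid t < real (semilength w)}"

definition multitunnels :: "path \<Rightarrow> (path \<times> path \<times> path) set" where
  "multitunnels w = {(A, B, C). w = A @ B @ C \<and> B \<noteq> [] \<and> is_dyck B}"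

definition centered_multitunnels :: "path \<Rightarrow> nat" where
  "centered_multitunnels w = card {(A, B, C) \<in> multitunnels w. length A = length C}"

section \<open>The map \<open>\<Phi>\<close>\<close>

definition matched :: "path \<Rightarrow> nat \<Rightarrow> nat \<Rightarrow> bool" where
  "matched w i j \<longleftrightarrow>
     (\<exists>(A, B, C) \<in> tunnels w. {i, j} = {length A + 1, length A + length B + 2})"

definition reading_order :: "nat \<Rightarrow> nat \<Rightarrow> nat" where
  "reading_order n i = (if odd i then (i + 1) div 2 else 2 * n + 1 - i div 2)"

text \<open>
  In a Dyck path every step is matched with exactly one other step, so "the matching step has
  already been read" is the same as "some matched step has already been read".
\<close>

definition mate_read :: "path \<Rightarrow> nat \<Rightarrow> bool" where
  "mate_read w i \<longleftrightarrow>
     (\<exists>k \<in> {1..<i}. matched w (reading_order (semilength w) i) (reading_order (semilength w) k))"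

definition Phi :: "path \<Rightarrow> path" where
  "Phi w = map (\<lambda>i. if mate_read w i then Down else Up) [1..<2 * semilength w + 1]"

end

theory Submission
  imports Defs
begin

text \<open>
  Number the steps of \<open>D\<close>, of length \<open>2n\<close>, from \<open>1\<close> to \<open>2n\<close>.  A tunnel is the same thing as
  an arc \<open>(a, b)\<close>: the positions \<open>a < b\<close> of its two matched steps.  The arcs form a perfect
  matching of the positions, so along the zigzag reading order they induce a fixed-point-free
  involution \<open>f\<close> on the reading times \<open>1, \<dots>, 2n\<close>, and step \<open>i\<close> of \<open>\<Phi>(D)\<close> is a down-step exactly
  when \<open>f i < i\<close>.

  Rises: each arc contributes one up-step to \<open>\<Phi>(D)\<close>, at the time when its first end is read.
  Odd times read from the left end of \<open>D\<close> and even times from the right end.  If the midpoint of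
  \<open>(a, b)\<close> is at most \<open>n\<close>, then \<open>a\<close> is read first, at an odd time; otherwise \<open>b\<close> is read first, at
  an even time (\<open>arc_reading_time\<close>).  This proves (2) and (3).

  Returns: the height of \<open>\<Phi>(D)\<close> after \<open>i\<close> steps counts the steps of \<open>D\<close> that are read by then while
  their mates are not (\<open>height_of_involution_word\<close>).  It vanishes iff the steps read so far are
  closed under matching; then \<open>i = 2j\<close> is even, and the unread steps, which fill the positions
  \<open>j + 1, \<dots>, 2n - j\<close>, are closed too.  A factor of a Dyck path is closed under matching iff it is
  itself a Dyck path (\<open>excursion_iff_mate_closed\<close>).  So the zeros of \<open>\<Phi>(D)\<close> correspond to the
  Dyck factors of \<open>D\<close> placed symmetrically about the middle.  A return is a zero with \<open>j > 0\<close>, and a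
  centered multitunnel is such a factor with \<open>j < n\<close>; as \<open>j = 0\<close> and \<open>j = n\<close> both qualify, the two
  counts agree, which is (4).

  Hills: a hill at times \<open>2j - 1, 2j\<close> lies between two consecutive zeros, so the steps read at these
  times, in the positions \<open>j\<close> and \<open>2n + 1 - j\<close>, can only be matched with each other; this is (1).
\<close>

section \<open>Heights and excursions\<close>

lemma height_append: "height (u @ v) = height u + height v"
  by (simp add: height_def)

lemma height_take_step:
  assumes "1 \<le> p" "p \<le> length w"
  shows "height (take p w) = height (take (p - 1) w) + rise (nth_step w p)"
proof -
  have "take p w = take (p - 1) w @ [w ! (p - 1)]"
    using assms take_Suc_conv_app_nth[of "p - 1" w] by simp
  then show ?thesis by (simp add: height_append nth_step_def height_def)
qed

lemma height_take_Up:
  assumes "1 \<le> p" "p \<le> length w" "nth_step w p = Up"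
  shows "height (take p w) = height (take (p - 1) w) + 1"
  using height_take_step[OF assms(1,2)] assms(3) by simp

lemma height_take_Down:
  assumes "1 \<le> p" "p \<le> length w" "nth_step w p = Down"
  shows "height (take p w) = height (take (p - 1) w) - 1"
  using height_take_step[OF assms(1,2)] assms(3) by simp

lemma even_height_iff: "even (height w) \<longleftrightarrow> even (length w)"
proof (induction w)
  case Nil
  then show ?case by (simp add: height_def)
next
  case (Cons s w)
  then show ?case by (cases s) (auto simp: height_def)
qed

lemma dyck_length: "is_dyck w \<Longrightarrow> length w = 2 * semilength w"
  using even_height_iff[of w] by (simp add: is_dyck_def semilength_def)

text \<open>
  Dyck factors are described by the heights of the whole path between the points with abscissae
  \<open>a\<close> and \<open>b\<close>, so that all arguments can refer to one height function instead of to factors.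
\<close>

definition excursion :: "path \<Rightarrow> nat \<Rightarrow> nat \<Rightarrow> bool" where
  "excursion w a b \<longleftrightarrow> height (take b w) = height (take a w)
     \<and> (\<forall>k\<in>{a..b}. height (take a w) \<le> height (take k w))"

lemma is_dyck_factor_iff:
  "is_dyck B \<longleftrightarrow> excursion (A @ B @ C) (length A) (length A + length B)"
proof -
  have shift: "height (take (length A + k) (A @ B @ C)) = height A + height (take k B)"
    if "k \<le> length B" for k
    using that by (simp add: height_append)
  have "(\<forall>k\<in>{length A..length A + length B}.
            height (take (length A) (A @ B @ C)) \<le> height (take k (A @ B @ C)))
        \<longleftrightarrow> (\<forall>k\<le>length B. 0 \<le> height (take k B))"
    (is "?L \<longleftrightarrow> ?R")
  proof
    assume L: ?L
    show ?R
    proof (intro allI impI)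
      fix k assume k: "k \<le> length B"
      then have "length A + k \<in> {length A..length A + length B}" by simp
      from L[rule_format, OF this] show "0 \<le> height (take k B)"
        unfolding shift[OF k] by simp
    qed
  next
    assume R: ?R
    show ?L
    proof
      fix k assume "k \<in> {length A..length A + length B}"
      then obtain l where l: "k = length A + l" "l \<le> length B"
        by (auto simp: le_iff_add)
      show "height (take (length A) (A @ B @ C)) \<le> height (take k (A @ B @ C))"
        unfolding l(1) shift[OF l(2)] using R l(2) by simp
    qed
  qed
  then show ?thesis
    using shift[of "length B"] by (simp add: excursion_def is_dyck_def height_append)
qed

section \<open>Tunnels as arcs between positions\<close>

text \<open>
  A step in position \<open>p\<close> joins the points with abscissae \<open>p - 1\<close> and \<open>p\<close>, hence the factor
  strictly between the steps \<open>a\<close> and \<open>b\<close> runs from \<open>a\<close> to \<open>b - 1\<close>.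
\<close>

definition arc :: "path \<Rightarrow> nat \<Rightarrow> nat \<Rightarrow> bool" where
  "arc w a b \<longleftrightarrow> 1 \<le> a \<and> a < b \<and> b \<le> length w
     \<and> nth_step w a = Up \<and> nth_step w b = Down \<and> excursion w a (b - 1)"

lemma tunnel_is_arc:
  assumes "(A, B, C) \<in> tunnels w"
  shows "arc w (length A + 1) (length A + length B + 2)"
proof -
  have w: "w = A @ [Up] @ B @ [Down] @ C" and B: "is_dyck B"
    using assms by (auto simp: tunnels_def)
  have "excursion w (length A + 1) (length A + length B + 1)"
    using B is_dyck_factor_iff[of B "A @ [Up]" "[Down] @ C"] w by simp
  moreover have "nth_step w (length A + 1) = Up" "nth_step w (length A + length B + 2) = Down"
    by (simp_all add: w nth_step_def nth_append)
  ultimately show ?thesis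
    by (simp add: arc_def w)
qed

lemma arc_is_tunnel:
  assumes "arc w a b"
  shows "(take (a - 1) w, take (b - 1 - a) (drop a w), drop b w) \<in> tunnels w"
proof -
  let ?A = "take (a - 1) w" and ?B = "take (b - 1 - a) (drop a w)" and ?C = "drop b w"
  have ab: "1 \<le> a" "a < b" "b \<le> length w" "w ! (a - 1) = Up" "w ! (b - 1) = Down"
    "excursion w a (b - 1)"
    using assms by (auto simp: arc_def nth_step_def)
  have "w = ?A @ [Up] @ drop a w"
    using id_take_nth_drop[of "a - 1" w] ab by simp
  moreover have "drop a w = ?B @ [Down] @ ?C"
    using id_take_nth_drop[of "b - 1 - a" "drop a w"] ab by simp
  ultimately have w: "w = ?A @ [Up] @ ?B @ [Down] @ ?C" by simp
  then have "excursion ((?A @ [Up]) @ ?B @ ([Down] @ ?C)) a (b - 1)"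
    using ab(6) by simp
  then have "is_dyck ?B"
    using is_dyck_factor_iff[of ?B "?A @ [Up]" "[Down] @ ?C"] ab(1-3) by simp
  with w show ?thesis unfolding tunnels_def by blast
qed

lemma bij_betw_tunnels_arcs:
  "bij_betw (\<lambda>(A, B, C). (length A + 1, length A + length B + 2))
     (tunnels w) {(a, b). arc w a b}"
  unfolding bij_betw_def
proof (intro conjI)
  show "inj_on (\<lambda>(A, B, C). (length A + 1, length A + length B + 2)) (tunnels w)"
    by (auto simp: inj_on_def tunnels_def)
  show "(\<lambda>(A, B, C). (length A + 1, length A + length B + 2)) ` tunnels w = {(a, b). arc w a b}"
  proof (intro equalityI subsetI)
    fix x assume "x \<in> (\<lambda>(A, B, C). (length A + 1, length A + length B + 2)) ` tunnels w"
    then show "x \<in> {(a, b). arc w a b}" using tunnel_is_arc by auto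
  next
    fix x assume "x \<in> {(a, b). arc w a b}"
    then obtain a b where x: "x = (a, b)" "arc w a b" by auto
    have "a = length (take (a - 1) w) + 1"
      "b = length (take (a - 1) w) + length (take (b - 1 - a) (drop a w)) + 2"
      using x(2) by (auto simp: arc_def)
    then show "x \<in> (\<lambda>(A, B, C). (length A + 1, length A + length B + 2)) ` tunnels w"
      using arc_is_tunnel[OF x(2)] x(1) by (auto intro!: rev_image_eqI)
  qed
qed

lemma card_tunnels_by_midpoint:
  "card {t \<in> tunnels w. P (tunnel_mid t)}
   = card {(a, b). arc w a b \<and> P ((real a + real b - 1) / 2)}"
proof (rule bij_betw_same_card[OF bij_betw_subset[OF bij_betw_tunnels_arcs[of w]]])
  let ?f = "\<lambda>(A :: path, B :: path, C :: path). (length A + 1, length A + length B + 2)"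
  define Q where "Q = (\<lambda>(a :: nat, b :: nat). P ((real a + real b - 1) / 2))"
  have P: "P (tunnel_mid t) \<longleftrightarrow> Q (?f t)" for t
    by (cases t) (simp add: Q_def algebra_simps)
  have "?f ` {t \<in> tunnels w. P (tunnel_mid t)} = {e \<in> ?f ` tunnels w. Q e}"
    unfolding P by blast
  also have "?f ` tunnels w = {(a, b). arc w a b}"
    using bij_betw_tunnels_arcs by (simp add: bij_betw_def)
  finally show "?f ` {t \<in> tunnels w. P (tunnel_mid t)}
      = {(a, b). arc w a b \<and> P ((real a + real b - 1) / 2)}"
    by (auto simp: Q_def)
qed auto

text \<open>
  Right after its down-step an arc drops below the level of its interior, which a longer arc with
  the same left end would have to stay above.  The next lemma is the mirror image.
\<close>

lemma arc_right_unique: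
  assumes "arc w a b" "arc w a b'"
  shows "b = b'"
proof -
  have False if "arc w a b" "arc w a b'" "b < b'" for b b'
  proof -
    have "height (take a w) \<le> height (take b w)"
      using that by (auto simp: arc_def excursion_def)
    moreover have "height (take b w) = height (take a w) - 1"
      using that height_take_Down[of b w] by (auto simp: arc_def excursion_def)
    ultimately show False by simp
  qed
  then show ?thesis using assms by (metis linorder_neqE_nat)
qed

lemma arc_left_unique:
  assumes "arc w a b" "arc w a' b"
  shows "a = a'"
proof -
  have False if "arc w a b" "arc w a' b" "a < a'" for a a'
  proof -
    have "a' - 1 \<in> {a..b - 1}" using that by (auto simp: arc_def)
    then have "height (take a w) \<le> height (take (a' - 1) w)"
      using that by (auto simp: arc_def excursion_def)
    moreover have "height (take a' w) = height (take (a' - 1) w) + 1"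
      using that height_take_Up[of a' w] by (auto simp: arc_def)
    ultimately show False using that by (auto simp: arc_def excursion_def)
  qed
  then show ?thesis using assms by (metis linorder_neqE_nat)
qed

text \<open>
  The mate of an up-step is the first later step that ends below the top of the up-step.  It exists
  because the path finally returns to level \<open>0\<close>.
\<close>

lemma ex_arc_from_Up:
  assumes w: "is_dyck w" and a: "1 \<le> a" "a \<le> length w" "nth_step w a = Up"
  shows "\<exists>b. arc w a b"
proof -
  let ?H = "\<lambda>k. height (take k w)"
  let ?P = "\<lambda>b. a < b \<and> b \<le> length w \<and> ?H b < ?H a"
  have Ha: "?H a = ?H (a - 1) + 1" using height_take_Up a by simp
  have "0 \<le> ?H (a - 1)" "?H (length w) = 0" using w a by (auto simp: is_dyck_def)
  then have "?P (length w)"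
    using Ha a(2) by (cases "a = length w") auto
  then obtain b where b: "?P b" and least: "\<And>k. k < b \<Longrightarrow> \<not> ?P k"
    using ex_least_nat_le[of ?P] by metis
  have above: "?H a \<le> ?H k" if "k \<in> {a..b - 1}" for k
  proof (cases "k = a")
    case False
    then have "a < k" "k < b" using that b by auto
    then show ?thesis using least[of k] b by auto
  qed simp
  have step: "?H b = ?H (b - 1) + rise (nth_step w b)" using height_take_step[of b w] b by simp
  have "?H a \<le> ?H (b - 1)" using above[of "b - 1"] b by auto
  then have "nth_step w b = Down" "?H (b - 1) = ?H a"
    using step b by (cases "nth_step w b"; simp)+
  then show ?thesis using a b above by (auto simp: arc_def excursion_def)
qed

text \<open>
  Symmetrically, the mate of a down-step is the last earlier step that starts below the top of the
  down-step; it exists because the path starts at level \<open>0\<close>.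
\<close>

lemma ex_arc_to_Down:
  assumes w: "is_dyck w" and b: "1 \<le> b" "b \<le> length w" "nth_step w b = Down"
  shows "\<exists>a. arc w a b"
proof -
  let ?H = "\<lambda>k. height (take k w)"
  let ?P = "\<lambda>c. c < b \<and> ?H c < ?H (b - 1)"
  have Hb: "?H b = ?H (b - 1) - 1" using height_take_Down b by simp
  have "0 \<le> ?H b" "?H 0 = 0" using w b by (auto simp: is_dyck_def height_def)
  then have P0: "?P 0" using Hb b by auto
  have bounded: "\<And>y. ?P y \<Longrightarrow> y \<le> b" by auto
  define c where "c = Greatest ?P"
  have c: "?P c" unfolding c_def by (rule GreatestI_nat[where P = ?P, OF P0 bounded])
  have greatest: "k \<le> c" if "?P k" for k
    unfolding c_def by (rule Greatest_le_nat[where P = ?P, OF that bounded])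
  have above: "?H (b - 1) \<le> ?H k" if "k \<in> {Suc c..b - 1}" for k
    using that greatest[of k] c by force
  have c1: "Suc c < b" using c by (metis Suc_lessI diff_Suc_1 less_irrefl)
  have step: "?H (Suc c) = ?H c + rise (nth_step w (Suc c))"
    using height_take_step[of "Suc c" w] b c1 by simp
  have "?H (b - 1) \<le> ?H (Suc c)" using above[of "Suc c"] c1 by auto
  then have "nth_step w (Suc c) = Up" "?H (Suc c) = ?H (b - 1)"
    using step c by (cases "nth_step w (Suc c)"; simp)+
  then have "arc w (Suc c) b" using b c1 above by (auto simp: arc_def excursion_def)
  then show ?thesis ..
qed

section \<open>The matching of the steps\<close>

lemma matched_iff_arc: "matched w p q \<longleftrightarrow> arc w p q \<or> arc w q p"
proof -
  have "matched w p q \<longleftrightarrow> (\<exists>(a, b) \<in> {(a, b). arc w a b}. {p, q} = {a, b})"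
    unfolding matched_def bij_betw_imp_surj_on[OF bij_betw_tunnels_arcs[of w], symmetric]
    by (simp add: case_prod_unfold)
  then show ?thesis by (auto simp: doubleton_eq_iff)
qed

lemma matched_sym: "matched w p q \<Longrightarrow> matched w q p"
  by (auto simp: matched_iff_arc)

lemma matched_unique: "matched w p q \<Longrightarrow> matched w p q' \<Longrightarrow> q = q'"
  using arc_left_unique arc_right_unique
  unfolding matched_iff_arc by (metis arc_def step.distinct(1))

lemma matched_range:
  "matched w p q \<Longrightarrow> q \<in> {1..length w} \<and> p \<noteq> q"
  by (auto simp: matched_iff_arc arc_def)

definition mate :: "path \<Rightarrow> nat \<Rightarrow> nat" where
  "mate w p = (THE q. matched w p q)"

lemma mate_eq: "matched w p q \<Longrightarrow> mate w p = q"
  unfolding mate_def using matched_unique by blast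

lemma matched_mate:
  assumes "is_dyck w" "p \<in> {1..length w}"
  shows "matched w p (mate w p)"
proof -
  have "\<exists>q. matched w p q"
    using ex_arc_from_Up[OF assms(1)] ex_arc_to_Down[OF assms(1)] assms(2)
    by (cases "nth_step w p") (auto simp: matched_iff_arc)
  then show ?thesis using mate_eq by blast
qed

text \<open>
  In a Dyck factor no step can be matched across an end, since the arc would pass through that end
  at a height that the factor excludes.  Conversely, if a closed factor left the half-plane above
  its starting level, its first step to do so would be a down-step matched outside; and if it ended
  too high, the step after its last visit to the starting level would be an up-step matched outside.
\<close>

lemma excursion_iff_mate_closed:
  assumes w: "is_dyck w" and ab: "a \<le> b" "b \<le> length w"
  shows "excursion w a b \<longleftrightarrow> (\<forall>p\<in>{a<..b}. mate w p \<in> {a<..b})"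
proof
  let ?H = "\<lambda>k. height (take k w)"
  assume E: "excursion w a b"
  have above: "?H a \<le> ?H k" if "a \<le> k" "k \<le> b" for k
    using E that by (auto simp: excursion_def)
  show "\<forall>p\<in>{a<..b}. mate w p \<in> {a<..b}"
  proof
    fix p assume p: "p \<in> {a<..b}"
    then have "matched w p (mate w p)" using matched_mate[OF w, of p] ab by auto
    then consider "arc w p (mate w p)" | "arc w (mate w p) p" by (auto simp: matched_iff_arc)
    then show "mate w p \<in> {a<..b}"
    proof cases
      case 1
      have "mate w p \<le> b"
      proof (rule ccontr)
        assume "\<not> mate w p \<le> b"
        then have "?H p \<le> ?H b" using 1 p by (auto simp: arc_def excursion_def)
        moreover have "?H p = ?H (p - 1) + 1" using 1 height_take_Up[of p w] by (auto simp: arc_def)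
        moreover have "?H a \<le> ?H (p - 1)" using above[of "p - 1"] p by auto
        ultimately show False using E by (auto simp: excursion_def)
      qed
      then show ?thesis using 1 p by (auto simp: arc_def)
    next
      case 2
      have "a < mate w p"
      proof (rule ccontr)
        assume "\<not> a < mate w p"
        then have "a \<in> {mate w p..p - 1}" using p by auto
        then have "?H (p - 1) \<le> ?H a" using 2 by (auto simp: arc_def excursion_def)
        moreover have "?H p = ?H (p - 1) - 1"
          using 2 height_take_Down[of p w] by (auto simp: arc_def)
        ultimately show False using above[of p] p by auto
      qed
      then show ?thesis using 2 p by (auto simp: arc_def)
    qed
  qed
next
  let ?H = "\<lambda>k. height (take k w)"
  assume closed: "\<forall>p\<in>{a<..b}. mate w p \<in> {a<..b}"
  have mate: "matched w p (mate w p) \<and> a < mate w p \<and> mate w p \<le> b" if "a < p" "p \<le> b" for p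
    using matched_mate[OF w, of p] closed that ab by auto
  have above: "?H a \<le> ?H k" if "a \<le> k" "k \<le> b" for k
  proof (rule ccontr)
    \<comment> \<open>The point \<open>l\<close> is where the factor first goes below its starting level; the mate of the
      step ending there starts at that same low level, contradicting the choice of \<open>l\<close>.\<close>
    let ?P = "\<lambda>k. a \<le> k \<and> k \<le> b \<and> ?H k < ?H a"
    assume "\<not> ?H a \<le> ?H k"
    with that have "?P k" by simp
    then obtain l where l: "?P l" and least: "\<And>i. i < l \<Longrightarrow> \<not> ?P i"
      using ex_least_nat_le[of ?P] by metis
    have al: "a < l" using l by (cases "a = l") auto
    have down: "nth_step w l = Down"
    proof (rule ccontr)
      assume "nth_step w l \<noteq> Down"
      then have "?H l = ?H (l - 1) + 1" using height_take_Up[of l w] al l ab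
        by (cases "nth_step w l") auto
      then show False using least[of "l - 1"] al l by auto
    qed
    then have arc: "arc w (mate w l) l" using mate[of l] al l by (auto simp: matched_iff_arc arc_def)
    then have "?H (mate w l) = ?H (mate w l - 1) + 1" "?H l = ?H (l - 1) - 1"
      using height_take_Up[of "mate w l" w] height_take_Down[of l w] by (auto simp: arc_def)
    then have "?H (mate w l - 1) = ?H l" using arc by (auto simp: arc_def excursion_def)
    moreover have "mate w l - 1 < l" using arc by (auto simp: arc_def)
    ultimately show False using least[of "mate w l - 1"] mate[of l] al l by auto
  qed
  have "?H b \<le> ?H a"
  proof (rule ccontr)
    assume high: "\<not> ?H b \<le> ?H a"
    \<comment> \<open>The point \<open>l\<close> is the last visit to the starting level; the mate of the step leaving it
      comes back to that level later and still inside the factor.\<close>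
    let ?P = "\<lambda>k. a \<le> k \<and> k \<le> b \<and> ?H k \<le> ?H a"
    have Pa: "?P a" using ab by simp
    have bounded: "\<And>y. ?P y \<Longrightarrow> y \<le> b" by auto
    define l where "l = Greatest ?P"
    have l: "?P l" unfolding l_def by (rule GreatestI_nat[where P = ?P, OF Pa bounded])
    have greatest: "k \<le> l" if "?P k" for k
      unfolding l_def by (rule Greatest_le_nat[where P = ?P, OF that bounded])
    have lb: "l < b" using l high by (cases "l = b") auto
    have up: "nth_step w (Suc l) = Up"
    proof (rule ccontr)
      assume "nth_step w (Suc l) \<noteq> Up"
      then have "?H (Suc l) = ?H l - 1" using height_take_Down[of "Suc l" w] lb ab
        by (cases "nth_step w (Suc l)") auto
      then show False using greatest[of "Suc l"] l lb by auto
    qed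
    let ?q = "mate w (Suc l)"
    have arc: "arc w (Suc l) ?q"
      using up mate[of "Suc l"] l lb by (auto simp: matched_iff_arc arc_def)
    then have "?H ?q = ?H (?q - 1) - 1" "?H (Suc l) = ?H l + 1"
      using height_take_Up[of "Suc l" w] height_take_Down[of ?q w] by (auto simp: arc_def)
    then have "?H ?q = ?H l" using arc by (auto simp: arc_def excursion_def)
    moreover have "l < ?q" using arc by (auto simp: arc_def)
    ultimately show False using greatest[of ?q] mate[of "Suc l"] l lb by auto
  qed
  then show "excursion w a b" using above ab by (auto simp: excursion_def intro: antisym)
qed

section \<open>Words of fixed-point-free involutions\<close>

text \<open>
  Think of each pair \<open>{k, f k}\<close> as opened by an up-step and closed by a down-step.  The height
  after \<open>i\<close> steps is then the number of pairs that are open at that time.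
\<close>

lemma height_of_involution_word:
  fixes f :: "nat \<Rightarrow> nat"
  assumes range: "\<And>k. k \<in> {1..N} \<Longrightarrow> f k \<in> {1..N}"
    and invol: "\<And>k. k \<in> {1..N} \<Longrightarrow> f (f k) = k"
    and no_fix: "\<And>k. k \<in> {1..N} \<Longrightarrow> f k \<noteq> k"
    and len: "length v = N"
    and steps: "\<And>k. k \<in> {1..N} \<Longrightarrow> nth_step v k = (if f k < k then Down else Up)"
    and "i \<le> N"
  shows "height (take i v) = int (card {k \<in> {1..i}. i < f k})"
  using \<open>i \<le> N\<close>
proof (induction i)
  case 0
  then show ?case by (simp add: height_def)
next
  case (Suc i)
  let ?s = "Suc i"
  have s: "?s \<in> {1..N}" using Suc.prems by simp
  have step: "height (take ?s v) = height (take i v) + rise (nth_step v ?s)"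
    using height_take_step[of ?s v] Suc.prems len by simp
  have closes: "f k = ?s \<longleftrightarrow> k = f ?s" if "k \<in> {1..N}" for k
    using invol[OF that] invol[OF s] by metis
  show ?case
  proof (cases "f ?s < ?s")
    case True
    \<comment> \<open>A down-step closes exactly the pair of \<open>f ?s\<close>; every other pair keeps its status.\<close>
    have "{k \<in> {1..i}. i < f k} = insert (f ?s) {k \<in> {1..?s}. ?s < f k}"
    proof (intro equalityI subsetI)
      fix k assume "k \<in> {k \<in> {1..i}. i < f k}"
      then show "k \<in> insert (f ?s) {k \<in> {1..?s}. ?s < f k}"
        using closes[of k] Suc.prems by force
    next
      fix k assume k: "k \<in> insert (f ?s) {k \<in> {1..?s}. ?s < f k}"
      have "k \<noteq> ?s" using k True by auto
      then show "k \<in> {k \<in> {1..i}. i < f k}"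
        using k True range[OF s] invol[OF s] by auto
    qed
    moreover have "f ?s \<notin> {k \<in> {1..?s}. ?s < f k}" using invol[OF s] by simp
    ultimately show ?thesis
      using Suc step steps[OF s] True by simp
  next
    case False
    then have "?s < f ?s" using no_fix[OF s] by simp
    then have "{k \<in> {1..?s}. ?s < f k} = insert ?s {k \<in> {1..i}. i < f k}"
    proof (intro equalityI subsetI)
      fix k assume "k \<in> insert ?s {k \<in> {1..i}. i < f k}"
      then show "k \<in> {k \<in> {1..?s}. ?s < f k}"
        using closes[of k] Suc.prems \<open>?s < f ?s\<close> by force
    next
      fix k assume "k \<in> {k \<in> {1..?s}. ?s < f k}"
      then show "k \<in> insert ?s {k \<in> {1..i}. i < f k}" by (cases "k = ?s") auto
    qed
    then show ?thesis
      using Suc step steps[OF s] False by simp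
  qed
qed

section \<open>Reading times\<close>

text \<open>
  The inverse of \<open>reading_order n\<close> on \<open>{1..2 * n}\<close>.
\<close>

definition reading_time :: "nat \<Rightarrow> nat \<Rightarrow> nat" where
  "reading_time n p = (if p \<le> n then 2 * p - 1 else 2 * (2 * n + 1 - p))"

lemma reading_order_range: "i \<in> {1..2 * n} \<Longrightarrow> reading_order n i \<in> {1..2 * n}"
  by (auto simp: reading_order_def)

lemma reading_time_range: "p \<in> {1..2 * n} \<Longrightarrow> reading_time n p \<in> {1..2 * n}"
  by (auto simp: reading_time_def)

lemma reading_time_order:
  assumes "i \<in> {1..2 * n}"
  shows "reading_time n (reading_order n i) = i"
proof (cases "odd i")
  case True
  then obtain j where "i = 2 * j + 1" by (auto elim: oddE)
  then show ?thesis using assms by (auto simp: reading_order_def reading_time_def)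
next
  case False
  then obtain j where "i = 2 * j" by (auto elim: evenE)
  then show ?thesis using assms by (auto simp: reading_order_def reading_time_def)
qed

lemma reading_order_time:
  assumes "p \<in> {1..2 * n}"
  shows "reading_order n (reading_time n p) = p"
proof (cases "p \<le> n")
  case True
  then obtain j where "p = Suc j" using assms by (cases p) auto
  then show ?thesis using True by (auto simp: reading_order_def reading_time_def)
next
  case False
  then show ?thesis using assms by (auto simp: reading_order_def reading_time_def)
qed

text \<open>
  After \<open>2 * j\<close> readings, exactly the first \<open>j\<close> and the last \<open>j\<close> positions have been read.
\<close>

lemma reading_time_gt_iff:
  assumes "p \<in> {1..2 * n}" "j \<le> n"
  shows "2 * j < reading_time n p \<longleftrightarrow> p \<in> {j<..2 * n - j}"
  using assms by (auto simp: reading_time_def)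

text \<open>
  The end of an arc that lies further from the middle of the path is read first.  For a centered
  arc both ends are equally far away, and the left end comes first because each round of the reading
  order starts on the left.
\<close>

lemma arc_reading_time:
  assumes "arc w a b" "length w = 2 * n"
  shows "a + b \<le> 2 * n + 1 \<Longrightarrow> reading_time n a = 2 * a - 1 \<and> reading_time n a < reading_time n b"
    and "2 * n + 1 < a + b \<Longrightarrow>
      reading_time n b = 2 * (2 * n + 1 - b) \<and> reading_time n b < reading_time n a"
  using assms by (auto simp: reading_time_def arc_def)

section \<open>The image path as the word of an involution\<close>

text \<open>The matching of \<open>w\<close>, carried over from positions to reading times.\<close>

definition time_mate :: "path \<Rightarrow> nat \<Rightarrow> nat" where
  "time_mate w i = reading_time (semilength w) (mate w (reading_order (semilength w) i))"

context
  fixes w :: path and n :: nat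
  assumes w: "is_dyck w" and n: "n = semilength w"
begin

lemma length_w: "length w = 2 * n"
  using dyck_length[OF w] n by simp

lemma mate_props:
  assumes "p \<in> {1..2 * n}"
  shows "mate w p \<in> {1..2 * n}" "mate w (mate w p) = p" "mate w p \<noteq> p"
proof -
  have m: "matched w p (mate w p)" using matched_mate[OF w] assms length_w by simp
  show "mate w p \<in> {1..2 * n}" "mate w p \<noteq> p" using matched_range[OF m] length_w by auto
  show "mate w (mate w p) = p" by (rule mate_eq[OF matched_sym[OF m]])
qed

lemma time_mate_reading_time:
  "p \<in> {1..2 * n} \<Longrightarrow> time_mate w (reading_time n p) = reading_time n (mate w p)"
  by (simp add: time_mate_def reading_order_time flip: n)

lemma time_mate_range: "i \<in> {1..2 * n} \<Longrightarrow> time_mate w i \<in> {1..2 * n}"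
  unfolding time_mate_def n[symmetric]
  by (intro reading_time_range mate_props(1) reading_order_range)

lemma time_mate_time_mate: "i \<in> {1..2 * n} \<Longrightarrow> time_mate w (time_mate w i) = i"
  unfolding time_mate_def n[symmetric]
  by (simp only: reading_order_time mate_props reading_order_range reading_time_order)

lemma time_mate_neq: "i \<in> {1..2 * n} \<Longrightarrow> time_mate w i \<noteq> i"
  unfolding time_mate_def n[symmetric]
  by (metis reading_order_time mate_props(1,3) reading_order_range)

lemma length_Phi: "length (Phi w) = 2 * n"
  by (simp add: Phi_def n)

lemma mate_read_iff:
  assumes i: "i \<in> {1..2 * n}"
  shows "mate_read w i \<longleftrightarrow> time_mate w i < i"
proof
  assume "mate_read w i"
  then obtain k where k: "k \<in> {1..<i}" "matched w (reading_order n i) (reading_order n k)"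
    by (auto simp: mate_read_def n)
  have "time_mate w i = k"
    using mate_eq[OF k(2)] reading_time_order[of k n] k(1) i
    by (simp add: time_mate_def flip: n)
  then show "time_mate w i < i" using k(1) by simp
next
  assume less: "time_mate w i < i"
  have "reading_order n (time_mate w i) = mate w (reading_order n i)"
    using mate_props(1)[OF reading_order_range[OF i]]
    by (simp only: time_mate_def reading_order_time flip: n)
  then have "matched w (reading_order n i) (reading_order n (time_mate w i))"
    using matched_mate[OF w, of "reading_order n i"] reading_order_range[OF i] length_w by simp
  then show "mate_read w i"
    using less time_mate_range[OF i] unfolding mate_read_def n by force
qed

lemma nth_step_Phi:
  assumes "i \<in> {1..2 * n}"
  shows "nth_step (Phi w) i = (if time_mate w i < i then Down else Up)"
  using assms mate_read_iff[OF assms]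
  by (auto simp: nth_step_def Phi_def n simp del: upt_Suc)

lemma height_Phi:
  assumes "i \<le> 2 * n"
  shows "height (take i (Phi w)) = int (card {k \<in> {1..i}. i < time_mate w k})"
  by (rule height_of_involution_word[of "2 * n"])
    (use time_mate_range time_mate_time_mate time_mate_neq length_Phi nth_step_Phi assms in auto)

lemma height_Phi_eq_0_iff:
  assumes "i \<le> 2 * n"
  shows "height (take i (Phi w)) = 0 \<longleftrightarrow> (\<forall>k\<in>{1..i}. time_mate w k \<le> i)"
  using height_Phi[OF assms] by (auto simp: not_less)

text \<open>
  The image is at level \<open>0\<close> after \<open>2 * j\<close> steps iff the set of steps already read is closed under
  matching.  As matching is an involution, this is the same as closure of the complement, which is
  an interval of positions.
\<close>

lemma height_Phi_double_eq_0_iff: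
  assumes j: "j \<le> n"
  shows "height (take (2 * j) (Phi w)) = 0 \<longleftrightarrow> excursion w j (2 * n - j)"
proof -
  let ?T = "reading_time n"
  have "height (take (2 * j) (Phi w)) = 0 \<longleftrightarrow> (\<forall>k\<in>{1..2 * j}. time_mate w k \<le> 2 * j)"
    using height_Phi_eq_0_iff j by simp
  also have "\<dots> \<longleftrightarrow> (\<forall>i\<in>{1..2 * n}. 2 * j < i \<longrightarrow> 2 * j < time_mate w i)" (is "?L \<longleftrightarrow> ?R")
  proof
    assume L: ?L
    show ?R
    proof (intro ballI impI, rule ccontr)
      fix i assume i: "i \<in> {1..2 * n}" "2 * j < i" "\<not> 2 * j < time_mate w i"
      then have "time_mate w (time_mate w i) \<le> 2 * j" using L time_mate_range[of i] by auto
      then show False using time_mate_time_mate[of i] i by simp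
    qed
  next
    assume R: ?R
    show ?L
    proof (intro ballI, rule ccontr)
      fix k assume k: "k \<in> {1..2 * j}" "\<not> time_mate w k \<le> 2 * j"
      then have k': "k \<in> {1..2 * n}" using j by auto
      then have "2 * j < time_mate w (time_mate w k)" using R k time_mate_range[of k] by auto
      then show False using time_mate_time_mate[OF k'] k by simp
    qed
  qed
  also have "\<dots> \<longleftrightarrow> (\<forall>p\<in>{1..2 * n}. 2 * j < ?T p \<longrightarrow> 2 * j < ?T (mate w p))"
    (is "_ \<longleftrightarrow> ?S")
  proof
    assume ?R
    then show ?S using time_mate_reading_time reading_time_range by metis
  next
    assume ?S
    then show ?R
      using time_mate_reading_time reading_order_range reading_time_order by metis
  qed
  also have "\<dots> \<longleftrightarrow> (\<forall>p\<in>{1..2 * n}. p \<in> {j<..2 * n - j} \<longrightarrow> mate w p \<in> {j<..2 * n - j})"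
    using reading_time_gt_iff mate_props(1) j by blast
  also have "\<dots> \<longleftrightarrow> (\<forall>p\<in>{j<..2 * n - j}. mate w p \<in> {j<..2 * n - j})"
    by auto
  also have "\<dots> \<longleftrightarrow> excursion w j (2 * n - j)"
    using excursion_iff_mate_closed[OF w, of j "2 * n - j"] j length_w by simp
  finally show ?thesis .
qed

lemma even_position_if_height_Phi_even:
  assumes "i \<le> 2 * n" "even (height (take i (Phi w)))"
  shows "even i"
  using assms even_height_iff[of "take i (Phi w)"] length_Phi by simp

lemma arc_time_mate:
  assumes "arc w a b"
  shows "time_mate w (reading_time n a) = reading_time n b"
    and "time_mate w (reading_time n b) = reading_time n a"
  using time_mate_reading_time[of a] time_mate_reading_time[of b]
    mate_eq[of w a b] mate_eq[of w b a] assms length_w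
  by (auto simp: matched_iff_arc arc_def)

section \<open>Rises of the image\<close>

lemma finite_arcs: "finite {(a, b). arc w a b \<and> Q a b}"
  by (rule finite_subset[of _ "{1..2 * n} \<times> {1..2 * n}"]) (use length_w in \<open>auto simp: arc_def\<close>)

lemma ex_arc_of_Phi_rise:
  assumes i: "i \<in> {1..2 * n}" and up: "nth_step (Phi w) i = Up"
  shows "\<exists>a b. arc w a b \<and>
    (a + b \<le> 2 * n + 1 \<and> i = 2 * a - 1 \<or> 2 * n + 1 < a + b \<and> i = 2 * (2 * n + 1 - b))"
proof -
  define p where "p = reading_order n i"
  have p: "p \<in> {1..2 * n}" "reading_time n p = i"
    using reading_order_range[OF i] reading_time_order[OF i] by (auto simp: p_def)
  have less: "reading_time n p < reading_time n (mate w p)"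
    using up nth_step_Phi[OF i] time_mate_neq[OF i] time_mate_reading_time[OF p(1)] p(2)
    by (auto split: if_splits)
  have "matched w p (mate w p)" using matched_mate[OF w] p length_w by simp
  then consider "arc w p (mate w p)" | "arc w (mate w p) p" by (auto simp: matched_iff_arc)
  then show ?thesis
  proof cases
    case 1
    then show ?thesis using arc_reading_time[OF 1 length_w] less p(2)
      by (metis less_asym not_less)
  next
    case 2
    then show ?thesis using arc_reading_time[OF 2 length_w] less p(2)
      by (metis less_asym not_less)
  qed
qed

lemma card_right_arcs: "card {(a, b). arc w a b \<and> 2 * n + 1 < a + b} = even_rises (Phi w)"
  unfolding even_rises_def length_Phi
proof (rule bij_betw_same_card[of "\<lambda>(a, b). 2 * (2 * n + 1 - b)"])
  show "bij_betw (\<lambda>(a, b). 2 * (2 * n + 1 - b)) {(a, b). arc w a b \<and> 2 * n + 1 < a + b}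
     {i \<in> {1..2 * n}. even i \<and> nth_step (Phi w) i = Up}"
    unfolding bij_betw_def
  proof (intro conjI equalityI subsetI)
    show "inj_on (\<lambda>(a, b). 2 * (2 * n + 1 - b)) {(a, b). arc w a b \<and> 2 * n + 1 < a + b}"
    proof (clarsimp simp: inj_on_def)
      fix a b a' b'
      assume arcs: "arc w a b" "arc w a' b'" and "Suc (2 * n) - b = Suc (2 * n) - b'"
      then have "b = b'" using length_w by (auto simp: arc_def)
      then show "a = a' \<and> b = b'" using arcs arc_left_unique by blast
    qed
  next
    fix x assume "x \<in> (\<lambda>(a, b). 2 * (2 * n + 1 - b)) ` {(a, b). arc w a b \<and> 2 * n + 1 < a + b}"
    then obtain a b where ab: "arc w a b" "2 * n + 1 < a + b" "x = 2 * (2 * n + 1 - b)" by auto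
    have x: "x = reading_time n b" "x < reading_time n a"
      using arc_reading_time(2)[OF ab(1) length_w ab(2)] ab(3) by auto
    have "x \<in> {1..2 * n}" using x reading_time_range[of b n] ab(1) length_w
      by (auto simp: arc_def)
    moreover have "even x" using ab(3) by simp
    ultimately show "x \<in> {i \<in> {1..2 * n}. even i \<and> nth_step (Phi w) i = Up}"
      using nth_step_Phi[of x] arc_time_mate[OF ab(1)] x by simp
  next
    fix i assume "i \<in> {i \<in> {1..2 * n}. even i \<and> nth_step (Phi w) i = Up}"
    then have i: "i \<in> {1..2 * n}" "even i" "nth_step (Phi w) i = Up" by auto
    obtain a b where ab: "arc w a b" "2 * n + 1 < a + b" "i = 2 * (2 * n + 1 - b)"
    proof -
      obtain a b where *: "arc w a b" "a + b \<le> 2 * n + 1 \<and> i = 2 * a - 1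
          \<or> 2 * n + 1 < a + b \<and> i = 2 * (2 * n + 1 - b)"
        using ex_arc_of_Phi_rise[OF i(1,3)] by blast
      have "odd (2 * a - 1)" using *(1) by (simp add: arc_def)
      then show thesis using * i(2) that by blast
    qed
    then show "i \<in> (\<lambda>(a, b). 2 * (2 * n + 1 - b)) ` {(a, b). arc w a b \<and> 2 * n + 1 < a + b}"
      by auto
  qed
qed

lemma card_left_or_centered_arcs:
  "card {(a, b). arc w a b \<and> a + b \<le> 2 * n + 1} = odd_rises (Phi w)"
  unfolding odd_rises_def length_Phi
proof (rule bij_betw_same_card[of "\<lambda>(a, b). 2 * a - 1"])
  show "bij_betw (\<lambda>(a, b). 2 * a - 1) {(a, b). arc w a b \<and> a + b \<le> 2 * n + 1}
     {i \<in> {1..2 * n}. odd i \<and> nth_step (Phi w) i = Up}"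
    unfolding bij_betw_def
  proof (intro conjI equalityI subsetI)
    show "inj_on (\<lambda>(a, b). 2 * a - 1) {(a, b). arc w a b \<and> a + b \<le> 2 * n + 1}"
    proof (clarsimp simp: inj_on_def)
      fix a b a' b'
      assume arcs: "arc w a b" "arc w a' b'" and "2 * a - Suc 0 = 2 * a' - Suc 0"
      then have "a = a'" by (auto simp: arc_def)
      then show "a = a' \<and> b = b'" using arcs arc_right_unique by blast
    qed
  next
    fix x assume "x \<in> (\<lambda>(a, b). 2 * a - 1) ` {(a, b). arc w a b \<and> a + b \<le> 2 * n + 1}"
    then obtain a b where ab: "arc w a b" "a + b \<le> 2 * n + 1" "x = 2 * a - 1" by auto
    have x: "x = reading_time n a" "x < reading_time n b"
      using arc_reading_time(1)[OF ab(1) length_w ab(2)] ab(3) by auto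
    have "x \<in> {1..2 * n}" using reading_time_range[of a n] ab(1) length_w x
      by (auto simp: arc_def)
    moreover have "odd x" using ab(1,3) by (simp add: arc_def)
    ultimately show "x \<in> {i \<in> {1..2 * n}. odd i \<and> nth_step (Phi w) i = Up}"
      using nth_step_Phi[of x] arc_time_mate[OF ab(1)] x by simp
  next
    fix i assume "i \<in> {i \<in> {1..2 * n}. odd i \<and> nth_step (Phi w) i = Up}"
    then have i: "i \<in> {1..2 * n}" "odd i" "nth_step (Phi w) i = Up" by auto
    obtain a b where "arc w a b" "a + b \<le> 2 * n + 1" "i = 2 * a - 1"
      using ex_arc_of_Phi_rise[OF i(1,3)] i(2) by auto
    then show "i \<in> (\<lambda>(a, b). 2 * a - 1) ` {(a, b). arc w a b \<and> a + b \<le> 2 * n + 1}"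
      by auto
  qed
qed

section \<open>Hills of the image\<close>

text \<open>
  A hill starts and ends at level \<open>0\<close>.  Everything read before it is matched among itself, so the
  two steps read during the hill are mates; by parity of the zeros they are read in the same round
  and hence lie symmetrically.  Conversely, the inside of a centered arc is a symmetric Dyck factor,
  so the image is at level \<open>0\<close> after both ends of the arc have been read.
\<close>

lemma hill_Phi_iff:
  assumes i: "1 \<le> i" "i < 2 * n"
  shows "nth_step (Phi w) i = Up \<and> nth_step (Phi w) (i + 1) = Down \<and> height (take i (Phi w)) = 1
     \<longleftrightarrow> (\<exists>a. arc w a (2 * n + 1 - a) \<and> i = 2 * a - 1)" (is "?hill \<longleftrightarrow> ?centered")
proof
  assume hill: ?hill
  let ?H = "\<lambda>k. height (take k (Phi w))"
  have "?H i = ?H (i - 1) + 1" "?H (i + 1) = ?H i - 1"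
    using height_take_Up[of i "Phi w"] height_take_Down[of "i + 1" "Phi w"] i hill length_Phi
    by auto
  then have zero: "?H (i - 1) = 0" "?H (i + 1) = 0" using hill by auto
  have "even (i + 1)" using even_position_if_height_Phi_even[of "i + 1"] zero i by simp
  then obtain a where a: "i + 1 = 2 * a" by (rule evenE)
  have i1: "i + 1 \<in> {1..2 * n}" using i by auto
  have "time_mate w (i + 1) < i + 1"
    using hill nth_step_Phi[OF i1] by (auto split: if_splits)
  moreover have "\<not> time_mate w (i + 1) \<le> i - 1"
  proof
    assume "time_mate w (i + 1) \<le> i - 1"
    then have "time_mate w (time_mate w (i + 1)) \<le> i - 1"
      using height_Phi_eq_0_iff[of "i - 1"] zero time_mate_range[OF i1] i by auto
    then show False using time_mate_time_mate[OF i1] by simp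
  qed
  ultimately have mate_i: "time_mate w (i + 1) = i" by simp
  have ia: "i = 2 * a - 1" "1 \<le> a" "a \<le> n" using a i by auto
  then have p: "reading_order n (i + 1) = 2 * n + 1 - a" "2 * n + 1 - a \<in> {1..2 * n}"
    "reading_order n i = a"
    by (auto simp: reading_order_def)
  have "reading_order n (time_mate w (i + 1)) = mate w (2 * n + 1 - a)"
    using mate_props(1)[OF p(2)] p(1) by (simp only: time_mate_def reading_order_time flip: n)
  then have "mate w (2 * n + 1 - a) = a" using mate_i p by simp
  then have "matched w (2 * n + 1 - a) a" using matched_mate[OF w, of "2 * n + 1 - a"] p length_w by simp
  moreover have "a < 2 * n + 1 - a" using a i by auto
  ultimately have "arc w a (2 * n + 1 - a)" by (auto simp: matched_iff_arc arc_def)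
  moreover have "i = 2 * a - 1" using a by simp
  ultimately show ?centered by blast
next
  assume ?centered
  then obtain a where arc: "arc w a (2 * n + 1 - a)" and ia: "i = 2 * a - 1" by blast
  have a: "1 \<le> a" "a \<le> n" "i + 1 = 2 * a" "2 * n + 1 - a - 1 = 2 * n - a"
    using arc ia by (auto simp: arc_def)
  have t: "reading_time n a = i" "reading_time n (2 * n + 1 - a) = i + 1"
    using a ia by (auto simp: reading_time_def)
  have up: "nth_step (Phi w) i = Up" and down: "nth_step (Phi w) (i + 1) = Down"
    using nth_step_Phi[of i] nth_step_Phi[of "i + 1"] arc_time_mate[OF arc] t i by auto
  have "height (take (i + 1) (Phi w)) = 0"
    using height_Phi_double_eq_0_iff[OF a(2)] arc a(3,4) by (simp add: arc_def)
  then have "height (take i (Phi w)) = 1"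
    using height_take_Down[of "i + 1" "Phi w"] down i length_Phi by simp
  then show ?hill using up down by simp
qed

lemma card_centered_arcs: "card {(a, b). arc w a b \<and> a + b = 2 * n + 1} = hills (Phi w)"
  unfolding hills_def length_Phi
proof (rule bij_betw_same_card[of "\<lambda>(a, b). 2 * a - 1"])
  let ?S = "{i. 1 \<le> i \<and> i < 2 * n \<and> nth_step (Phi w) i = Up \<and> nth_step (Phi w) (i + 1) = Down
                      \<and> height (take i (Phi w)) = 1}"
  have S: "?S = {i. 1 \<le> i \<and> i < 2 * n \<and> (\<exists>a. arc w a (2 * n + 1 - a) \<and> i = 2 * a - 1)}"
    using hill_Phi_iff by blast
  show "bij_betw (\<lambda>(a, b). 2 * a - 1) {(a, b). arc w a b \<and> a + b = 2 * n + 1} ?S"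
    unfolding bij_betw_def
  proof (intro conjI)
    show "inj_on (\<lambda>(a, b). 2 * a - 1) {(a, b). arc w a b \<and> a + b = 2 * n + 1}"
      by (auto simp: inj_on_def arc_def)
    show "(\<lambda>(a, b). 2 * a - 1) ` {(a, b). arc w a b \<and> a + b = 2 * n + 1} = ?S"
      unfolding S
    proof (intro equalityI subsetI)
      fix x assume "x \<in> (\<lambda>(a, b). 2 * a - 1) ` {(a, b). arc w a b \<and> a + b = 2 * n + 1}"
      then obtain a b where ab: "arc w a b" "a + b = 2 * n + 1" "x = 2 * a - 1" by auto
      then have "b = 2 * n + 1 - a" "1 \<le> a" "a \<le> n" by (auto simp: arc_def)
      then show "x \<in> {i. 1 \<le> i \<and> i < 2 * n \<and> (\<exists>a. arc w a (2 * n + 1 - a) \<and> i = 2 * a - 1)}"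
        using ab by auto
    next
      fix i assume "i \<in> {i. 1 \<le> i \<and> i < 2 * n \<and> (\<exists>a. arc w a (2 * n + 1 - a) \<and> i = 2 * a - 1)}"
      then obtain a where a: "arc w a (2 * n + 1 - a)" "i = 2 * a - 1" by auto
      then have "a + (2 * n + 1 - a) = 2 * n + 1" by (auto simp: arc_def)
      then show "i \<in> (\<lambda>(a, b). 2 * a - 1) ` {(a, b). arc w a b \<and> a + b = 2 * n + 1}"
        using a by (intro image_eqI[of _ _ "(a, 2 * n + 1 - a)"]) auto
    qed
  qed
qed

section \<open>Returns of the image\<close>

lemma returns_Phi: "returns (Phi w) = card {j \<in> {1..n}. excursion w j (2 * n - j)}"
proof -
  have "{i \<in> {1..2 * n}. nth_step (Phi w) i = Down \<and> height (take i (Phi w)) = 0}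
        = (*) 2 ` {j \<in> {1..n}. excursion w j (2 * n - j)}" (is "?L = ?R")
  proof (intro equalityI subsetI)
    fix i assume "i \<in> ?L"
    then have i: "i \<in> {1..2 * n}" "height (take i (Phi w)) = 0" by auto
    then obtain j where j: "i = 2 * j" using even_position_if_height_Phi_even[of i] by (auto elim: evenE)
    then have "j \<in> {1..n}" using i by auto
    then show "i \<in> ?R" using height_Phi_double_eq_0_iff[of j] i j by auto
  next
    fix i assume "i \<in> ?R"
    then obtain j where j: "j \<in> {1..n}" "excursion w j (2 * n - j)" "i = 2 * j" by auto
    then have i: "i \<in> {1..2 * n}" and zero: "height (take i (Phi w)) = 0"
      using height_Phi_double_eq_0_iff[of j] by auto
    have "time_mate w i \<le> i" using height_Phi_eq_0_iff[of i] zero i by auto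
    then have "nth_step (Phi w) i = Down" using nth_step_Phi[OF i] time_mate_neq[OF i] by auto
    then show "i \<in> ?L" using i zero by simp
  qed
  then show ?thesis
    unfolding returns_def length_Phi by (simp add: card_image inj_on_def)
qed

lemma centered_multitunnels_eq:
  "centered_multitunnels w = card {j \<in> {0..<n}. excursion w j (2 * n - j)}"
  unfolding centered_multitunnels_def
proof (rule bij_betw_same_card[of "\<lambda>(A, B, C). length A"])
  let ?M = "{(A, B, C) \<in> multitunnels w. length A = length C}"
  have M: "(A, B, C) \<in> ?M \<longleftrightarrow> w = A @ B @ C \<and> B \<noteq> [] \<and> is_dyck B \<and> length A = length C" for A B C
    by (auto simp: multitunnels_def)
  show "bij_betw (\<lambda>(A, B, C). length A) ?M {j \<in> {0..<n}. excursion w j (2 * n - j)}"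
    unfolding bij_betw_def
  proof (intro conjI equalityI subsetI)
    show "inj_on (\<lambda>(A, B, C). length A) ?M"
    proof (rule inj_onI)
      fix x y assume xy: "x \<in> ?M" "y \<in> ?M" "(\<lambda>(A, B, C). length A) x = (\<lambda>(A, B, C). length A) y"
      obtain A B C A' B' C' where *: "x = (A, B, C)" "y = (A', B', C')" by (cases x, cases y)
      have len: "length A = length A'" "length C = length C'" "A @ B @ C = A' @ B' @ C'"
        using xy unfolding * M by auto
      then show "x = y" unfolding * by (auto simp: append_eq_append_conv)
    qed
  next
    fix j assume "j \<in> (\<lambda>(A, B, C). length A) ` ?M"
    then obtain A B C where ABC: "w = A @ B @ C" "B \<noteq> []" "is_dyck B" "length A = length C"
      "j = length A"
      by (auto simp: multitunnels_def)
    have len: "2 * n = length A + length B + length A" using length_w ABC by simp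
    moreover have "0 < length B" using ABC by simp
    ultimately have "j < n" "2 * n - j = length A + length B" using ABC(5) by arith+
    then show "j \<in> {j \<in> {0..<n}. excursion w j (2 * n - j)}"
      using is_dyck_factor_iff[of B A C] ABC by simp
  next
    fix j assume "j \<in> {j \<in> {0..<n}. excursion w j (2 * n - j)}"
    then have j: "j < n" "excursion w j (2 * n - j)" by auto
    let ?A = "take j w" and ?B = "take (2 * n - j - j) (drop j w)" and ?C = "drop (2 * n - j) w"
    have "2 * n - j - j + j = 2 * n - j" using j by simp
    then have "drop (2 * n - j - j) (drop j w) = ?C" by (simp only: drop_drop)
    then have split: "?A @ ?B @ ?C = w" by (metis append_take_drop_id)
    have len: "length ?A = j" "length ?C = j" "length ?B = 2 * n - j - j" using j length_w by auto
    have "is_dyck ?B"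
      using is_dyck_factor_iff[of ?B ?A ?C] j unfolding split len by simp
    moreover have "?B \<noteq> []" using len(3) j by fastforce
    ultimately have "(?A, ?B, ?C) \<in> ?M" unfolding M using split len by simp
    then show "j \<in> (\<lambda>(A, B, C). length A) ` ?M" using len(1) by force
  qed
qed

text \<open>
  The two index sets differ only in the extreme values: \<open>0\<close> stands for the whole path and \<open>n\<close> for
  the empty factor in the middle, and both are excursions.
\<close>

lemma card_centered_excursions:
  "card {j \<in> {0..<n}. excursion w j (2 * n - j)} = card {j \<in> {1..n}. excursion w j (2 * n - j)}"
proof -
  let ?E = "\<lambda>j. excursion w j (2 * n - j)"
  have "?E 0" using w length_w by (auto simp: excursion_def is_dyck_def height_def)
  moreover have "?E n" by (simp add: excursion_def)
  ultimately have "insert n {j \<in> {0..<n}. ?E j} = insert 0 {j \<in> {1..n}. ?E j}"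
    by (auto simp: le_less Suc_le_eq)
  then have "card (insert n {j \<in> {0..<n}. ?E j}) = card (insert 0 {j \<in> {1..n}. ?E j})"
    by simp
  then show ?thesis by simp
qed

end

section \<open>Tunnel statistics of a path and the statistics of its image\<close>

theorem theorem2:
  fixes D D' :: path
  assumes "is_dyck D"
    and "D' = Phi D"
  shows "centered_tunnels D = hills D'
       \<and> right_tunnels D = even_rises D'
       \<and> left_tunnels D + centered_tunnels D = odd_rises D'
       \<and> centered_multitunnels D = returns D'"
proof -
  let ?n = "semilength D"
  note [simp] = assms(2)
  have mid: "(real a + real b - 1) / 2 = real ?n \<longleftrightarrow> a + b = 2 * ?n + 1"
    "(real a + real b - 1) / 2 > real ?n \<longleftrightarrow> 2 * ?n + 1 < a + b"
    "(real a + real b - 1) / 2 < real ?n \<longleftrightarrow> a + b < 2 * ?n + 1" for a b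
    by (simp_all add: field_simps flip: of_nat_add of_nat_mult of_nat_Suc) linarith+
  have ct: "centered_tunnels D = card {(a, b). arc D a b \<and> a + b = 2 * ?n + 1}"
    by (simp only: centered_tunnels_def mid
          card_tunnels_by_midpoint[of D "\<lambda>x. x = real ?n"])
  have rt: "right_tunnels D = card {(a, b). arc D a b \<and> 2 * ?n + 1 < a + b}"
    by (simp only: right_tunnels_def mid
          card_tunnels_by_midpoint[of D "\<lambda>x. x > real ?n"])
  have lt: "left_tunnels D = card {(a, b). arc D a b \<and> a + b < 2 * ?n + 1}"
    by (simp only: left_tunnels_def mid
          card_tunnels_by_midpoint[of D "\<lambda>x. x < real ?n"])
  have "left_tunnels D + centered_tunnels D
      = card ({(a, b). arc D a b \<and> a + b < 2 * ?n + 1} \<union> {(a, b). arc D a b \<and> a + b = 2 * ?n + 1})"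
    unfolding lt ct
    by (rule card_Un_disjoint[symmetric]) (use finite_arcs[OF assms(1) refl] in auto)
  also have "{(a, b). arc D a b \<and> a + b < 2 * ?n + 1} \<union> {(a, b). arc D a b \<and> a + b = 2 * ?n + 1}
      = {(a, b). arc D a b \<and> a + b \<le> 2 * ?n + 1}"
    by auto
  also have "card \<dots> = odd_rises D'"
    using card_left_or_centered_arcs[OF assms(1) refl] by simp
  finally have "left_tunnels D + centered_tunnels D = odd_rises D'" .
  moreover have "centered_multitunnels D = returns D'"
    using centered_multitunnels_eq[OF assms(1) refl] card_centered_excursions[OF assms(1) refl]
      returns_Phi[OF assms(1) refl] by simp
  ultimately show ?thesis
    using ct rt card_centered_arcs[OF assms(1) refl] card_right_arcs[OF assms(1) refl] by simp
qed

end
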